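(* For every $\omega\in\mathcal{X}_0^{\mathrm{per}}$ we have $\frac15\le\delta(\omega)\le\frac12$. There are exactly $2$ periodic configurations (elements of $\mathcal{X}_0^{\mathrm{per}}$) with density $\frac12$ and exactly $10$ periodic configurations (elements of $\mathcal{X}_0^{\mathrm{per}}$) with density $\frac15$.
   Context: $\mathbb{Z}^2$ is the square grid graph, with $i\sim j$ iff $\|i-j\|_1=1$. $\mathcal{X}_0\subset\{0,1\}^{\mathbb{Z}^2}$ is the set of configurations $\omega$ such that for every $i\in\mathbb{Z}^2$: $\omega_i=1$ if and only if $\omega_j=0$ for all four neighbors $j\sim i$ (equivalently, $\{i:\omega_i=1\}$ is a maximal independent set of the grid). A configuration $\omega\in\mathcal{X}_0$ is called periodic if there exists $v\in\mathbb{Z}^2$ such that $\omega_i=\omega_{i+v}$ for all $i\in\mathbb{Z}^2$; $\mathcal{X}_0^{\mathrm{per}}$ is the set of periodic configurations in $\mathcal{X}_0$. With $U_n=\{-n,\dots,n\}^2$ and $|\omega_{U_n}|$ the number of $i\in U_n$ with $\omega_i=1$, the density of $\omega\in\mathcal{X}_0^{\mathrm{per}}$ is $\delta(\omega):=\lim_{n\to\infty}|\omega_{U_n}|/|U_n|$.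
   Formalization: "Periodic" is taken to mean having two linearly independent periods: with a single period v the density may not exist, and infinitely many configurations (two opposite checkerboards joined along an empty column) have density 1/2. *)

theory Defs
  imports Complex_Main "HOL-Library.Product_Plus"
begin

text \<open>A configuration in $\{0,1\}^{\mathbb{Z}^2}$ is a predicate on sites: \<open>\<omega> i\<close> means $\omega_i = 1$.\<close>

type_synonym site = "int \<times> int"
type_synonym config = "site \<Rightarrow> bool"

definition adj :: "site \<Rightarrow> site \<Rightarrow> bool" where
  "adj i j \<longleftrightarrow> \<bar>fst i - fst j\<bar> + \<bar>snd i - snd j\<bar> = 1"

definition X0 :: "config set" where
  "X0 = {\<omega>. \<forall>i. \<omega> i \<longleftrightarrow> (\<forall>j. adj j i \<longrightarrow> \<not> \<omega> j)}"

definition is_period :: "config \<Rightarrow> site \<Rightarrow> bool" where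
  "is_period \<omega> v \<longleftrightarrow> (\<forall>i. \<omega> i = \<omega> (i + v))"

text \<open>
  Periodicity is understood in the full-rank sense: there are two linearly independent
  periods (nonvanishing determinant). A single period is not enough: the zero vector is a
  period of every configuration, and with only one nonzero period the density need not
  exist. Moreover the two checkerboards can be joined along an empty column (both
  neighbouring columns being occupied at opposite parities), which gives infinitely many
  configurations with period $(0,2)$ and density $1/2$.
\<close>

definition periodic :: "config \<Rightarrow> bool" where
  "periodic \<omega> \<longleftrightarrow>
     (\<exists>v w. is_period \<omega> v \<and> is_period \<omega> w \<and> fst v * snd w - snd v * fst w \<noteq> 0)"

definition X0_per :: "config set" where
  "X0_per = {\<omega> \<in> X0. periodic \<omega>}"

definition box :: "nat \<Rightarrow> site set" where
  "box n = {- int n..int n} \<times> {- int n..int n}"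

definition box_density :: "config \<Rightarrow> nat \<Rightarrow> real" where
  "box_density \<omega> n = real (card {i \<in> box n. \<omega> i}) / real (card (box n))"

text \<open>Meaningful only if \<open>box_density \<omega>\<close> converges; otherwise \<open>lim\<close> is unspecified.\<close>

definition density :: "config \<Rightarrow> real" where
  "density \<omega> = lim (box_density \<omega>)"

end

theory Submission
  imports Defs "HOL-Real_Asymp.Real_Asymp"
begin

text \<open>
  A configuration with two independent periods is periodic in both coordinate directions with a
  common period \<open>M\<close>, so its density exists and is its average over an \<open>M \<times> M\<close> torus
  (\<open>box_density_tendsto\<close>).  On the torus, averages are invariant under translation.  Hence, if a
  finite window \<open>W\<close> always contains at least (or always at most) \<open>b\<close> occupied sites, wherever it is
  placed, then the density is at least (at most) \<open>b / |W|\<close>, with equality only if every translate of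
  \<open>W\<close> contains exactly \<open>b\<close> occupied sites (\<open>window_average_ge\<close>, \<open>window_average_le\<close>).

  Independence of the occupied set bounds the two dominoes by 1; maximality says that every cross,
  a site with its four neighbours, meets the set.  This gives the bounds 1/2 and 1/5, and turns
  each extremal case into a rigid local condition.  Density 1/2 means that occupation alternates
  along both axes, which leaves the two checkerboards.  Density 1/5 means that the crosses centred
  at the occupied sites tile the grid, that is, the occupied set is a perfect code.  In a
  perfect code the site diagonally above an occupied site forces an occupied site at exactly one of
  the knight moves \<open>(2, 1)\<close> and \<open>(1, 2)\<close>; one knight move then forces its quarter turns
  (\<open>knight_turn\<close>), hence a whole translate of a lattice of index 5
  (\<open>perfect_code_from_knight\<close>).  Two lattices with five translates each make ten configurations.
\<close>

section \<open>Sums over a period\<close>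

lemma period_sum_shift:
  fixes g :: "int \<Rightarrow> real"
  assumes "\<And>x. g (x + int M) = g x"
  shows "(\<Sum>k<M. g (a + int k)) = (\<Sum>k<M. g (int k))"
proof -
  have step: "(\<Sum>k<M. g (b + 1 + int k)) = (\<Sum>k<M. g (b + int k))" for b
  proof -
    have "g b + (\<Sum>k<M. g (b + 1 + int k)) = (\<Sum>k<Suc M. g (b + int k))"
      by (simp only: sum.lessThan_Suc_shift) (simp add: algebra_simps)
    then show ?thesis using assms[of b] by simp
  qed
  show ?thesis
  proof (induction a rule: int_induct[where k = 0])
    case (step2 i)
    then show ?case using step[of "i - 1"] by simp
  qed (use step in simp_all)
qed

lemma period_sum_blocks:
  fixes g :: "int \<Rightarrow> real"
  assumes "\<And>x. g (x + int M) = g x"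
  shows "(\<Sum>k<q * M. g (a + int k)) = real q * (\<Sum>k<M. g (int k))"
proof (induction q arbitrary: a)
  case (Suc q)
  have "{..<Suc q * M} = {..<M} \<union> {M..<M + q * M}" by auto
  then have "(\<Sum>k<Suc q * M. g (a + int k))
      = (\<Sum>k<M. g (a + int k)) + (\<Sum>k = M..<M + q * M. g (a + int k))"
    by (simp only:) (rule sum.union_disjoint; force)
  also have "(\<Sum>k = M..<M + q * M. g (a + int k)) = (\<Sum>k<q * M. g (a + int M + int k))"
    using sum.shift_bounds_nat_ivl[of "\<lambda>k. g (a + int k)" 0 M "q * M"]
    by (simp add: lessThan_atLeast0 add.commute add.left_commute)
  finally show ?case
    using Suc.IH[of "a + int M"] period_sum_shift[of g M a, OF assms] by (simp add: algebra_simps)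
qed simp

text \<open>
  Among \<open>N\<close> consecutive points there are \<open>N div M\<close> disjoint full periods, and one period more covers
  all of them.
\<close>

lemma period_sum_bounds:
  fixes g :: "int \<Rightarrow> real"
  assumes per: "\<And>x. g (x + int M) = g x" and "\<And>x. g x \<ge> 0" and "M > 0"
  shows "real (N div M) * (\<Sum>k<M. g (int k)) \<le> (\<Sum>k<N. g (a + int k))"
    and "(\<Sum>k<N. g (a + int k)) \<le> real (N div M + 1) * (\<Sum>k<M. g (int k))"
proof -
  have "N \<le> (N div M + 1) * M"
    using \<open>M > 0\<close> by (metis Suc_eq_plus1 dividend_less_div_times less_imp_le mult_Suc)
  then have "{..<N div M * M} \<subseteq> {..<N}" "{..<N} \<subseteq> {..<(N div M + 1) * M}"
    using div_times_less_eq_dividend[of N M] by auto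
  then show "real (N div M) * (\<Sum>k<M. g (int k)) \<le> (\<Sum>k<N. g (a + int k))"
    "(\<Sum>k<N. g (a + int k)) \<le> real (N div M + 1) * (\<Sum>k<M. g (int k))"
    unfolding period_sum_blocks[of g M, OF per, symmetric, of _ a]
    using assms(2) by (auto intro!: sum_mono2)
qed

section \<open>Averages of doubly periodic functions\<close>

definition doubly_periodic :: "nat \<Rightarrow> (site \<Rightarrow> real) \<Rightarrow> bool" where
  "doubly_periodic M f \<longleftrightarrow>
     M > 0 \<and> (\<forall>x y. f (x + int M, y) = f (x, y) \<and> f (x, y + int M) = f (x, y))"

definition torus_sum :: "nat \<Rightarrow> (site \<Rightarrow> real) \<Rightarrow> real" where
  "torus_sum M f = (\<Sum>j<M. \<Sum>k<M. f (int j, int k))"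

lemma doubly_periodic_shift:
  assumes "doubly_periodic M f"
  shows "doubly_periodic M (\<lambda>i. f (i + v))"
proof -
  obtain a b where v: "v = (a, b)" by fastforce
  have "f (x + int M + a, y + b) = f (x + a, y + b)" "f (x + a, y + int M + b) = f (x + a, y + b)" for x y
  proof -
    have "x + int M + a = x + a + int M" "y + int M + b = y + b + int M" by simp_all
    then show "f (x + int M + a, y + b) = f (x + a, y + b)"
      "f (x + a, y + int M + b) = f (x + a, y + b)"
      using assms by (simp_all only: doubly_periodic_def)
  qed
  then show ?thesis using assms by (simp add: doubly_periodic_def v)
qed

lemma torus_sum_shift:
  assumes "doubly_periodic M f"
  shows "torus_sum M (\<lambda>i. f (i + v)) = torus_sum M f"
proof -
  obtain a b where v: "v = (a, b)" by fastforce
  have "torus_sum M (\<lambda>i. f (i + v)) = (\<Sum>j<M. \<Sum>k<M. f (a + int j, b + int k))"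
    by (simp add: torus_sum_def v add.commute)
  also have "\<dots> = (\<Sum>j<M. \<Sum>k<M. f (a + int j, int k))"
    using assms by (intro sum.cong refl period_sum_shift) (simp add: doubly_periodic_def)
  also have "\<dots> = torus_sum M f"
    using assms unfolding torus_sum_def
    by (intro period_sum_shift[of "\<lambda>x. \<Sum>k<M. f (x, int k)"]) (simp add: doubly_periodic_def)
  finally show ?thesis .
qed

text \<open>
  After translating by \<open>v\<close>, the value at \<open>v\<close> is the term of the torus sum with index \<open>(0, 0)\<close>.
\<close>

lemma torus_sum_nonneg_zero:
  assumes "doubly_periodic M f" "\<And>i. f i \<ge> 0" "torus_sum M f = 0"
  shows "f v = 0"
proof -
  have "(\<Sum>j<M. \<Sum>k<M. f ((int j, int k) + v)) = 0"
    using torus_sum_shift[OF assms(1), of v] assms(3) by (simp add: torus_sum_def)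
  then have "\<forall>j<M. \<forall>k<M. f ((int j, int k) + v) = 0"
    using assms(2) by (simp add: sum_nonneg_eq_0_iff sum_nonneg)
  then have "f ((int 0, int 0) + v) = 0"
    using assms(1) unfolding doubly_periodic_def by blast
  then show ?thesis by (cases v) simp
qed

text \<open>
  Double counting: each site lies in \<open>card W\<close> translates of \<open>W\<close>, so summing the window sums over the
  torus counts the torus sum \<open>card W\<close> times.  The excess over \<open>b\<close> is a nonnegative periodic function,
  and its total vanishes only if it vanishes identically.
\<close>

lemma window_average_ge:
  assumes per: "doubly_periodic M f" and W: "finite W" "W \<noteq> {}"
    and ge: "\<And>i. (\<Sum>w\<in>W. f (i + w)) \<ge> b"
  shows "b / real (card W) \<le> torus_sum M f / (real M)\<^sup>2"
    and "torus_sum M f / (real M)\<^sup>2 = b / real (card W) \<longleftrightarrow> (\<forall>i. (\<Sum>w\<in>W. f (i + w)) = b)"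
proof -
  define g where "g i = (\<Sum>w\<in>W. f (i + w)) - b" for i
  have g: "doubly_periodic M g" "\<And>i. g i \<ge> 0"
    using per doubly_periodic_shift[OF per] ge unfolding g_def doubly_periodic_def by auto
  have M: "real M > 0" and c: "real (card W) > 0"
    using per W by (auto simp: doubly_periodic_def card_gt_0_iff)
  have "torus_sum M (\<lambda>i. \<Sum>w\<in>W. f (i + w)) = (\<Sum>w\<in>W. torus_sum M (\<lambda>i. f (i + w)))"
    unfolding torus_sum_def by (subst (2) sum.swap, subst sum.swap[of _ W]) simp
  then have eq: "torus_sum M g = real (card W) * torus_sum M f - (real M)\<^sup>2 * b"
    using torus_sum_shift[OF per]
    by (simp add: g_def torus_sum_def sum_subtractf power2_eq_square)
  have ge0: "torus_sum M g \<ge> 0" using g(2) by (simp add: torus_sum_def sum_nonneg)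
  then show "b / real (card W) \<le> torus_sum M f / (real M)\<^sup>2"
    using eq M c by (simp add: field_simps)
  have "torus_sum M f / (real M)\<^sup>2 = b / real (card W) \<longleftrightarrow> torus_sum M g = 0"
    using eq M c by (auto simp add: field_simps)
  also have "\<dots> \<longleftrightarrow> (\<forall>i. g i = 0)"
    using torus_sum_nonneg_zero[OF g] by (auto simp: torus_sum_def)
  finally show "torus_sum M f / (real M)\<^sup>2 = b / real (card W) \<longleftrightarrow> (\<forall>i. (\<Sum>w\<in>W. f (i + w)) = b)"
    by (simp add: g_def)
qed

lemma window_average_le:
  assumes per: "doubly_periodic M f" and W: "finite W" "W \<noteq> {}"
    and le: "\<And>i. (\<Sum>w\<in>W. f (i + w)) \<le> b"
  shows "torus_sum M f / (real M)\<^sup>2 \<le> b / real (card W)"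
    and "torus_sum M f / (real M)\<^sup>2 = b / real (card W) \<longleftrightarrow> (\<forall>i. (\<Sum>w\<in>W. f (i + w)) = b)"
proof -
  have "doubly_periodic M (\<lambda>i. - f i)" using per by (simp add: doubly_periodic_def)
  note * = window_average_ge[OF this W, of "- b"]
  have m: "torus_sum M (\<lambda>i. - f i) = - torus_sum M f" by (simp add: torus_sum_def sum_negf)
  show "torus_sum M f / (real M)\<^sup>2 \<le> b / real (card W)"
    "torus_sum M f / (real M)\<^sup>2 = b / real (card W) \<longleftrightarrow> (\<forall>i. (\<Sum>w\<in>W. f (i + w)) = b)"
    using * le by (simp_all add: m sum_negf)
qed

section \<open>The density of a periodic configuration\<close>

definition occ :: "config \<Rightarrow> site \<Rightarrow> real" where
  "occ \<omega> i = of_bool (\<omega> i)"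

lemma is_period_add:
  assumes "is_period \<omega> u" "is_period \<omega> v"
  shows "is_period \<omega> (u + v)"
  unfolding is_period_def
proof
  fix i
  have "\<omega> i = \<omega> (i + u)" "\<omega> (i + u) = \<omega> (i + u + v)" using assms by (simp_all only: is_period_def)
  then show "\<omega> i = \<omega> (i + (u + v))" by (simp only: add.assoc)
qed

lemma is_period_uminus:
  assumes "is_period \<omega> u"
  shows "is_period \<omega> (- u)"
  unfolding is_period_def
proof
  fix i
  have "\<omega> (i - u) = \<omega> (i - u + u)" using assms by (simp only: is_period_def)
  then show "\<omega> i = \<omega> (i + - u)" by simp
qed

lemma is_period_multiple:
  assumes "is_period \<omega> (a, b)"
  shows "is_period \<omega> (k * a, k * b)"
proof (induction k rule: int_induct[where k = 0])
  case base
  then show ?case by (simp add: is_period_def)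
next
  case (step1 i)
  then show ?case using is_period_add[OF step1(2) assms] by (simp add: algebra_simps)
next
  case (step2 i)
  then show ?case
    using is_period_add[OF step2(2) is_period_uminus[OF assms]] by (simp add: algebra_simps)
qed

text \<open>
  Cramer's rule: integer combinations of the two periods give multiples of the unit vectors by their
  determinant.
\<close>

lemma periodic_imp_doubly_periodic:
  assumes "periodic \<omega>"
  shows "\<exists>M. doubly_periodic M (occ \<omega>)"
proof -
  obtain a b c d where p: "is_period \<omega> (a, b)" "is_period \<omega> (c, d)" and "a * d - b * c \<noteq> 0"
    using assms unfolding periodic_def by auto
  define D where "D = a * d - b * c"
  have 1: "is_period \<omega> (D, 0)"
    using is_period_add[OF is_period_multiple[OF p(1), of d] is_period_multiple[OF p(2), of "- b"]]
    by (simp add: D_def algebra_simps)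
  have 2: "is_period \<omega> (0, D)"
    using is_period_add[OF is_period_multiple[OF p(1), of "- c"] is_period_multiple[OF p(2), of a]]
    by (simp add: D_def algebra_simps)
  have 3: "is_period \<omega> (\<bar>D\<bar>, 0)" and 4: "is_period \<omega> (0, \<bar>D\<bar>)"
    using is_period_multiple[OF 1, of "sgn D"] is_period_multiple[OF 2, of "sgn D"]
    by (simp_all add: mult_sgn_abs abs_sgn mult.commute)
  have "\<omega> (x + \<bar>D\<bar>, y) = \<omega> (x, y)" "\<omega> (x, y + \<bar>D\<bar>) = \<omega> (x, y)" for x y
    using 3[unfolded is_period_def, THEN spec, of "(x, y)"] 4[unfolded is_period_def, THEN spec, of "(x, y)"]
    by simp_all
  moreover have "\<bar>D\<bar> > 0" using \<open>a * d - b * c \<noteq> 0\<close> by (simp add: D_def)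
  ultimately have "doubly_periodic (nat \<bar>D\<bar>) (occ \<omega>)"
    by (simp add: doubly_periodic_def occ_def)
  then show ?thesis by blast
qed

lemma box_count:
  "real (card {i \<in> box n. \<omega> i})
    = (\<Sum>j<2 * n + 1. \<Sum>k<2 * n + 1. occ \<omega> (- int n + int j, - int n + int k))"
proof -
  have img: "{- int n..int n} = (\<lambda>k. - int n + int k) ` {..<2 * n + 1}"
  proof (intro equalityI subsetI)
    fix x assume "x \<in> {- int n..int n}"
    then show "x \<in> (\<lambda>k. - int n + int k) ` {..<2 * n + 1}"
      by (intro image_eqI[of _ _ "nat (x + int n)"]) auto
  qed auto
  have inj: "inj_on (\<lambda>k. - int n + int k) {..<2 * n + 1}" by (simp add: inj_on_def)
  have fin: "finite (box n)" by (simp add: box_def)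
  have "real (card {i \<in> box n. \<omega> i}) = (\<Sum>i\<in>box n. occ \<omega> i)"
    using fin by (simp add: occ_def sum_of_bool_eq Collect_conj_eq)
  also have "\<dots> = (\<Sum>x\<in>{- int n..int n}. \<Sum>y\<in>{- int n..int n}. occ \<omega> (x, y))"
    unfolding box_def by (subst sum.cartesian_product) (simp add: case_prod_unfold)
  also have "\<dots> = (\<Sum>j<2 * n + 1. \<Sum>k<2 * n + 1. occ \<omega> (- int n + int j, - int n + int k))"
    unfolding img by (simp only: sum.reindex[OF inj] o_def)
  finally show ?thesis .
qed

text \<open>
  The box of side \<open>2 n + 1\<close> is compared with \<open>q\<close> by \<open>q\<close> and \<open>q + 1\<close> by \<open>q + 1\<close> arrays of period
  squares, where \<open>q\<close> is the integer part of \<open>(2 n + 1) / M\<close>; both have the same asymptotic share of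
  the box.
\<close>

lemma box_density_tendsto:
  assumes "doubly_periodic M (occ \<omega>)"
  shows "box_density \<omega> \<longlonglongrightarrow> torus_sum M (occ \<omega>) / (real M)\<^sup>2"
proof -
  let ?S = "torus_sum M (occ \<omega>)"
  have M: "M > 0" and px: "\<And>x y. occ \<omega> (x + int M, y) = occ \<omega> (x, y)"
    and py: "\<And>x y. occ \<omega> (x, y + int M) = occ \<omega> (x, y)"
    using assms by (auto simp: doubly_periodic_def)
  have nn: "occ \<omega> i \<ge> 0" for i by (simp add: occ_def)
  have S: "?S \<ge> 0" by (simp add: torus_sum_def nn sum_nonneg)
  have count: "(real (N div M))\<^sup>2 * ?S \<le> real (card {i \<in> box n. \<omega> i})
      \<and> real (card {i \<in> box n. \<omega> i}) \<le> (real (N div M + 1))\<^sup>2 * ?S"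
    if N: "N = 2 * n + 1" for n N
  proof -
    let ?row = "\<lambda>x. \<Sum>k<M. occ \<omega> (x, int k)"
    note row = period_sum_bounds[where g = "\<lambda>y. occ \<omega> (_, y)" and N = N and a = "- int n", OF py nn M]
    note col = period_sum_bounds[where g = ?row and N = N and a = "- int n", OF _ _ M,
        unfolded px, OF refl sum_nonneg[OF nn]]
    have "(real (N div M))\<^sup>2 * ?S \<le> real (N div M) * (\<Sum>j<N. ?row (- int n + int j))"
      unfolding power2_eq_square torus_sum_def mult.assoc by (intro mult_left_mono col(1)) simp
    also have "\<dots> \<le> real (card {i \<in> box n. \<omega> i})"
      unfolding box_count N[symmetric] sum_distrib_left[of _ _ "{..<N}"] by (intro sum_mono row(1))
    finally have lower: "(real (N div M))\<^sup>2 * ?S \<le> real (card {i \<in> box n. \<omega> i})" .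
    have "real (card {i \<in> box n. \<omega> i}) \<le> real (N div M + 1) * (\<Sum>j<N. ?row (- int n + int j))"
      unfolding box_count N[symmetric] sum_distrib_left[of _ _ "{..<N}"] by (intro sum_mono row(2))
    also have "\<dots> \<le> (real (N div M + 1))\<^sup>2 * ?S"
      unfolding power2_eq_square torus_sum_def mult.assoc by (intro mult_left_mono col(2)) simp
    finally show ?thesis using lower by simp
  qed
  have dens: "box_density \<omega> n = real (card {i \<in> box n. \<omega> i}) / (2 * real n + 1)\<^sup>2" for n
  proof -
    have "card (box n) = (2 * n + 1)\<^sup>2"
      by (simp add: box_def power2_eq_square flip: nat_mult_distrib) (simp add: nat_add_distrib nat_mult_distrib algebra_simps)
    then show ?thesis by (simp add: box_density_def)
  qed
  \<comment> \<open>Replacing the integer quotient by the real one costs at most 1 and makes both bounds explicit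
    rational functions of \<open>n\<close>.\<close>
  define q where "q n = (2 * real n + 1) / real M" for n
  have qb: "real ((2 * n + 1) div M) \<le> q n" "q n - 1 \<le> real ((2 * n + 1) div M)" for n
  proof -
    have "2 * n + 1 = (2 * n + 1) div M * M + (2 * n + 1) mod M" by simp
    then have "2 * real n + 1 = real ((2 * n + 1) div M) * real M + real ((2 * n + 1) mod M)"
      by (metis of_nat_add of_nat_mult of_nat_1 of_nat_numeral)
    moreover have "real ((2 * n + 1) mod M) \<le> real M" using M by (simp add: less_imp_le)
    ultimately show "real ((2 * n + 1) div M) \<le> q n" "q n - 1 \<le> real ((2 * n + 1) div M)"
      unfolding q_def using M by (simp_all add: field_simps)
  qed
  have lower: "\<forall>\<^sub>F n in sequentially. (q n - 1)\<^sup>2 * ?S / (2 * real n + 1)\<^sup>2 \<le> box_density \<omega> n"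
    using eventually_ge_at_top[of M]
  proof eventually_elim
    case (elim n)
    \<comment> \<open>Squaring the lower bound \<open>q n - 1\<close> requires it to be nonnegative.\<close>
    then have "q n \<ge> 1" using M by (simp add: q_def field_simps)
    then have "(q n - 1)\<^sup>2 * ?S \<le> (real ((2 * n + 1) div M))\<^sup>2 * ?S"
      using qb[of n] S by (intro mult_right_mono power_mono) auto
    then show ?case using count[OF refl, of n] by (simp add: dens divide_right_mono)
  qed
  have upper: "box_density \<omega> n \<le> (q n + 1)\<^sup>2 * ?S / (2 * real n + 1)\<^sup>2" for n
  proof -
    have "(real ((2 * n + 1) div M + 1))\<^sup>2 * ?S \<le> (q n + 1)\<^sup>2 * ?S"
      using qb[of n] S by (intro mult_right_mono power_mono) auto
    then show ?thesis using count[OF refl, of n] by (simp add: dens divide_right_mono)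
  qed
  have lower_lim: "(\<lambda>n. (q n - 1)\<^sup>2 * ?S / (2 * real n + 1)\<^sup>2) \<longlonglongrightarrow> ?S / (real M)\<^sup>2"
  proof -
    have "(\<lambda>n. (q n - 1) / (2 * real n + 1)) \<longlonglongrightarrow> 1 / real M"
      unfolding q_def using M by (real_asymp simp: field_simps)
    from tendsto_mult_right[OF tendsto_power[OF this, of 2], of ?S] show ?thesis
      by (simp add: power_divide)
  qed
  have upper_lim: "(\<lambda>n. (q n + 1)\<^sup>2 * ?S / (2 * real n + 1)\<^sup>2) \<longlonglongrightarrow> ?S / (real M)\<^sup>2"
  proof -
    have "(\<lambda>n. (q n + 1) / (2 * real n + 1)) \<longlonglongrightarrow> 1 / real M"
      unfolding q_def using M by (real_asymp simp: field_simps)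
    from tendsto_mult_right[OF tendsto_power[OF this, of 2], of ?S] show ?thesis
      by (simp add: power_divide)
  qed
  show ?thesis
    by (rule tendsto_sandwich[OF lower always_eventually lower_lim upper_lim]) (intro allI upper)
qed

lemma periodic_density:
  assumes "periodic \<omega>"
  obtains M where "doubly_periodic M (occ \<omega>)" "convergent (box_density \<omega>)"
    "density \<omega> = torus_sum M (occ \<omega>) / (real M)\<^sup>2"
proof -
  obtain M where M: "doubly_periodic M (occ \<omega>)"
    using periodic_imp_doubly_periodic[OF assms] by blast
  note lim = box_density_tendsto[OF M]
  show ?thesis
    by (rule that[OF M convergentI[OF lim]]) (simp only: density_def limI[OF lim])
qed

section \<open>Density one half: the checkerboards\<close>

lemma adj_iff:
  "adj j i \<longleftrightarrow> j \<in> {i + (1, 0), i + (- 1, 0), i + (0, 1), i + (0, - 1)}"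
proof -
  obtain a b c d where [simp]: "i = (a, b)" "j = (c, d)" by fastforce
  have "\<bar>c - a\<bar> + \<bar>d - b\<bar> = 1 \<longleftrightarrow>
      c = a + 1 \<and> d = b \<or> c = a - 1 \<and> d = b \<or> c = a \<and> d = b + 1 \<or> c = a \<and> d = b - 1"
    by arith
  then show ?thesis by (simp add: adj_def)
qed

lemma X0_iff:
  "\<omega> \<in> X0 \<longleftrightarrow> (\<forall>i. \<omega> i \<longleftrightarrow>
     \<not> \<omega> (i + (1, 0)) \<and> \<not> \<omega> (i + (- 1, 0)) \<and> \<not> \<omega> (i + (0, 1)) \<and> \<not> \<omega> (i + (0, - 1)))"
proof -
  have "(\<forall>j. adj j i \<longrightarrow> \<not> \<omega> j) \<longleftrightarrow>
     \<not> \<omega> (i + (1, 0)) \<and> \<not> \<omega> (i + (- 1, 0)) \<and> \<not> \<omega> (i + (0, 1)) \<and> \<not> \<omega> (i + (0, - 1))" for i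
    unfolding adj_iff by blast
  then show ?thesis by (simp only: X0_def mem_Collect_eq)
qed

lemma domino_sum:
  assumes "e \<noteq> 0"
  shows "(\<Sum>w\<in>{0, e}. occ \<omega> (i + w)) = occ \<omega> i + occ \<omega> (i + e)"
  using assms by (subst sum.insert) auto

text \<open>
  Two adjacent sites are never both occupied, so the window \<open>{0, e}\<close> has sum at most 1.
\<close>

lemma domino_density:
  assumes "\<omega> \<in> X0_per" and e: "e \<in> {(1, 0), (0, 1)}"
  shows "density \<omega> \<le> 1 / 2"
    and "density \<omega> = 1 / 2 \<longleftrightarrow> (\<forall>i. \<omega> (i + e) = (\<not> \<omega> i))"
proof -
  obtain M where M: "doubly_periodic M (occ \<omega>)" and d: "density \<omega> = torus_sum M (occ \<omega>) / (real M)\<^sup>2"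
    using assms periodic_density unfolding X0_per_def by blast
  have X: "\<omega> \<in> X0" using assms by (simp add: X0_per_def)
  have "fst e + snd e = 1" using e by auto
  then have e0: "e \<noteq> 0" by auto
  have c: "card {0, e} = 2" using e0 by simp
  have le: "(\<Sum>w\<in>{0, e}. occ \<omega> (i + w)) \<le> 1" for i
    using X[unfolded X0_iff, rule_format, of i] e unfolding domino_sum[OF e0] by (auto simp: occ_def)
  have eq: "(\<Sum>w\<in>{0, e}. occ \<omega> (i + w)) = 1 \<longleftrightarrow> \<omega> (i + e) = (\<not> \<omega> i)" for i
    unfolding domino_sum[OF e0] by (auto simp: occ_def)
  have fin: "finite {0, e}" "{0, e} \<noteq> {}" by simp_all
  note bound = window_average_le[OF M fin le, unfolded c eq of_nat_numeral]
  show "density \<omega> \<le> 1 / 2" unfolding d by (rule bound(1))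
  show "density \<omega> = 1 / 2 \<longleftrightarrow> (\<forall>i. \<omega> (i + e) = (\<not> \<omega> i))" unfolding d by (rule bound(2))
qed

definition alternating :: "config \<Rightarrow> bool" where
  "alternating \<omega> \<longleftrightarrow> (\<forall>i. \<omega> (i + (1, 0)) = (\<not> \<omega> i) \<and> \<omega> (i + (0, 1)) = (\<not> \<omega> i))"

definition checkerboard :: "bool \<Rightarrow> config" where
  "checkerboard b = (\<lambda>(x, y). even (x + y) = b)"

lemma alternating_iff: "alternating \<omega> \<longleftrightarrow> (\<exists>b. \<omega> = checkerboard b)"
proof
  assume "alternating \<omega>"
  then have alt: "\<omega> (i + (1, 0)) = (\<not> \<omega> i) \<and> \<omega> (i + (0, 1)) = (\<not> \<omega> i)" for i
    unfolding alternating_def by (rule spec)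
  have x: "\<omega> (x + 1, y) = (\<not> \<omega> (x, y))" and y: "\<omega> (x, y + 1) = (\<not> \<omega> (x, y))" for x y
    using alt[of "(x, y)"] unfolding add_Pair add_0_right by blast+
  have row: "\<omega> (x, 0) \<longleftrightarrow> even x = \<omega> (0, 0)" for x
  proof (induction x rule: int_induct[where k = 0])
    case (step2 i) then show ?case using x[of "i - 1" 0] by auto
  qed (auto simp: x)
  have col: "\<omega> (x, y) \<longleftrightarrow> even y = \<omega> (x, 0)" for x y
  proof (induction y rule: int_induct[where k = 0])
    case (step2 i) then show ?case using y[of x "i - 1"] by auto
  qed (auto simp: y)
  have "\<omega> i = checkerboard (\<omega> (0, 0)) i" for i
    using row[of "fst i"] col[of "fst i" "snd i"] by (cases i) (auto simp: checkerboard_def)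
  then show "\<exists>b. \<omega> = checkerboard b" by (intro exI ext)
qed (auto simp: alternating_def checkerboard_def)

lemma checkerboard_X0_per: "checkerboard b \<in> X0_per"
proof -
  have "is_period (checkerboard b) (2, 0)" "is_period (checkerboard b) (0, 2)"
    by (auto simp: is_period_def checkerboard_def)
  then have "periodic (checkerboard b)"
    unfolding periodic_def by (intro exI[of _ "(2, 0)"] exI[of _ "(0, 2)"]) simp
  moreover have "checkerboard b \<in> X0"
    unfolding X0_iff by (auto simp: checkerboard_def)
  ultimately show ?thesis by (simp add: X0_per_def)
qed

text \<open>
  Equality for the horizontal and for the vertical domino together is alternation in both
  directions, which determines the configuration from its value at the origin.
\<close>

lemma density_half: "{\<omega> \<in> X0_per. density \<omega> = 1/2} = range checkerboard"
proof -
  have "density \<omega> = 1 / 2 \<longleftrightarrow> alternating \<omega>" if "\<omega> \<in> X0_per" for \<omega>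
    using domino_density(2)[OF that, of "(1, 0)"] domino_density(2)[OF that, of "(0, 1)"]
    unfolding alternating_def by blast
  then show ?thesis using alternating_iff checkerboard_X0_per by auto
qed

lemma inj_checkerboard: "inj checkerboard"
proof (rule injI)
  fix a b assume "checkerboard a = checkerboard b"
  then have "checkerboard a (0, 0) = checkerboard b (0, 0)" by simp
  then show "a = b" by (simp add: checkerboard_def)
qed

section \<open>Density one fifth: perfect codes\<close>

definition cross :: "site set" where
  "cross = {(0, 0), (1, 0), (- 1, 0), (0, 1), (0, - 1)}"

text \<open>
  The occupied set is a perfect code: by symmetry of \<open>cross\<close>, each site lies in the cross of exactly
  one occupied site.
\<close>

definition perfect :: "config \<Rightarrow> bool" where
  "perfect \<omega> \<longleftrightarrow> (\<forall>i. \<exists>!w. w \<in> cross \<and> \<omega> (i + w))"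

lemma cross_sum: "(\<Sum>w\<in>cross. occ \<omega> (i + w)) = real (card {w \<in> cross. \<omega> (i + w)})"
proof -
  have "finite cross" by (simp add: cross_def)
  then show ?thesis by (simp add: occ_def sum_of_bool_eq Collect_conj_eq)
qed

text \<open>
  A site is occupied or, by maximality, has an occupied neighbour; so every cross has sum at least 1.
\<close>

lemma cross_density:
  assumes "\<omega> \<in> X0_per"
  shows "1 / 5 \<le> density \<omega>" and "density \<omega> = 1 / 5 \<longleftrightarrow> perfect \<omega>"
proof -
  obtain M where M: "doubly_periodic M (occ \<omega>)" and d: "density \<omega> = torus_sum M (occ \<omega>) / (real M)\<^sup>2"
    using assms periodic_density unfolding X0_per_def by blast
  have X: "\<omega> \<in> X0" using assms by (simp add: X0_per_def)
  have fin: "finite cross" "cross \<noteq> {}" and c: "card cross = 5" by (simp_all add: cross_def)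
  have "{w \<in> cross. \<omega> (i + w)} \<noteq> {}" for i
  proof -
    have "i + (0, 0) = i" by (cases i) simp
    moreover have "\<omega> i \<or> \<omega> (i + (1, 0)) \<or> \<omega> (i + (- 1, 0)) \<or> \<omega> (i + (0, 1)) \<or> \<omega> (i + (0, - 1))"
      using X unfolding X0_iff by blast
    ultimately have "\<exists>w\<in>cross. \<omega> (i + w)" by (simp only: cross_def bex_simps) blast
    then show ?thesis by blast
  qed
  then have ge: "(\<Sum>w\<in>cross. occ \<omega> (i + w)) \<ge> 1" for i
    unfolding cross_sum using fin by (simp add: Suc_le_eq card_gt_0_iff)
  have eq: "(\<Sum>w\<in>cross. occ \<omega> (i + w)) = 1 \<longleftrightarrow> (\<exists>!w. w \<in> cross \<and> \<omega> (i + w))" for i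
    unfolding cross_sum of_nat_eq_1_iff is_singleton_altdef[symmetric] is_singleton_iff_ex1
    by (simp only: mem_Collect_eq)
  note bound = window_average_ge[OF M fin ge, unfolded c eq of_nat_numeral]
  show "1 / 5 \<le> density \<omega>" "density \<omega> = 1 / 5 \<longleftrightarrow> perfect \<omega>"
    unfolding d perfect_def by (rule bound)+
qed

lemma perfect_dominates:
  assumes "perfect \<omega>"
  shows "\<omega> (x, y) \<or> \<omega> (x + 1, y) \<or> \<omega> (x - 1, y) \<or> \<omega> (x, y + 1) \<or> \<omega> (x, y - 1)"
proof -
  obtain w where "w \<in> cross" "\<omega> ((x, y) + w)" using assms unfolding perfect_def by blast
  then show ?thesis by (auto simp: cross_def)
qed

text \<open>
  Crosses centred at distance at most 2 overlap, and a common site would be covered twice.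
\<close>

lemma perfect_separated:
  assumes "perfect \<omega>" "\<omega> (x, y)" "\<omega> (x + a, y + b)" "\<bar>a\<bar> + \<bar>b\<bar> \<le> 2"
  shows "a = 0 \<and> b = 0"
proof -
  have diff: "v = w" if "v \<in> cross" "w \<in> cross" "a = fst w - fst v" "b = snd w - snd v" for v w
  proof -
    have "((x, y) - v) + v = (x, y)" "((x, y) - v) + w = (x + a, y + b)"
      using that(3,4) by (cases v; cases w; simp)+
    then have "\<omega> (((x, y) - v) + v)" "\<omega> (((x, y) - v) + w)"
      using assms(2,3) by (simp_all only:)
    then show ?thesis using assms(1) that unfolding perfect_def by blast
  qed
  have "a \<in> {-2, -1, 0, 1, 2}" "b \<in> {-2, -1, 0, 1, 2}" using assms(4) by auto
  then have "(a, b) \<in> {(0, 0), (1, 0), (- 1, 0), (0, 1), (0, - 1), (2, 0), (- 2, 0), (0, 2), (0, - 2),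
      (1, 1), (1, - 1), (- 1, 1), (- 1, - 1)}"
    using assms(4) by (elim insertE; simp)
  \<comment> \<open>These thirteen vectors are exactly the differences of two elements of the cross.\<close>
  then have "\<exists>v\<in>cross. \<exists>w\<in>cross. a = fst w - fst v \<and> b = snd w - snd v"
    unfolding cross_def by (elim insertE) simp_all
  then show ?thesis using diff by fastforce
qed

lemma perfect_imp_X0:
  assumes "perfect \<omega>"
  shows "\<omega> \<in> X0"
  unfolding X0_iff
proof
  fix i :: site
  obtain x y where i: "i = (x, y)" by fastforce
  show "\<omega> i \<longleftrightarrow>
     \<not> \<omega> (i + (1, 0)) \<and> \<not> \<omega> (i + (- 1, 0)) \<and> \<not> \<omega> (i + (0, 1)) \<and> \<not> \<omega> (i + (0, - 1))"
    using perfect_dominates[OF assms, of x y] perfect_separated[OF assms, of x y 1 0]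
      perfect_separated[OF assms, of x y "-1" 0] perfect_separated[OF assms, of x y 0 1]
      perfect_separated[OF assms, of x y 0 "-1"]
    by (auto simp: i)
qed

text \<open>
  For \<open>(a, b) = (1, 0)\<close> the knight move is \<open>(2, 1)\<close> and its clockwise quarter turn is \<open>(1, -2)\<close>.  The
  site at \<open>(1, -1)\<close> has to be covered.  Itself and its neighbours at \<open>(1, 0)\<close> and \<open>(0, -1)\<close> are too
  close to the origin, and \<open>(2, -1)\<close> is too close to \<open>(2, 1)\<close>; only \<open>(1, -2)\<close> remains.  The other unit
  vectors \<open>(a, b)\<close> give the rotated situations.
\<close>

lemma knight_turn:
  assumes P: "perfect \<omega>" and ab: "\<bar>a\<bar> + \<bar>b\<bar> = 1"
    and 1: "\<omega> (x, y)" and 2: "\<omega> (x + 2 * a - b, y + 2 * b + a)"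
  shows "\<omega> (x + a + 2 * b, y + b - 2 * a)"
proof -
  have s1: "\<not> \<omega> (x + u, y + v)" if "\<bar>u\<bar> + \<bar>v\<bar> \<le> 2" "u \<noteq> 0 \<or> v \<noteq> 0" for u v
    using perfect_separated[OF P 1] that by blast
  have s2: "\<not> \<omega> (x + 2 * a - b + u, y + 2 * b + a + v)" if "\<bar>u\<bar> + \<bar>v\<bar> \<le> 2" "u \<noteq> 0 \<or> v \<noteq> 0" for u v
    using perfect_separated[OF P 2] that by blast
  consider "a = 1" "b = 0" | "a = -1" "b = 0" | "a = 0" "b = 1" | "a = 0" "b = -1"
    using ab by arith
  then show ?thesis
  proof cases
    case 1
    then show ?thesis
      using perfect_dominates[OF P, of "x + 1" "y - 1"] s1[of 1 "-1"] s1[of 0 "-1"] s1[of 1 0] s2[of 0 "-2"]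
      by (simp add: ac_simps)
  next
    case 2
    then show ?thesis
      using perfect_dominates[OF P, of "x - 1" "y + 1"] s1[of "-1" 1] s1[of 0 1] s1[of "-1" 0] s2[of 0 2]
      by (simp add: ac_simps)
  next
    case 3
    then show ?thesis
      using perfect_dominates[OF P, of "x + 1" "y + 1"] s1[of 1 1] s1[of 0 1] s1[of 1 0] s2[of 2 0]
      by (simp add: ac_simps)
  next
    case 4
    then show ?thesis
      using perfect_dominates[OF P, of "x - 1" "y - 1"] s1[of "-1" "-1"] s1[of 0 "-1"] s1[of "-1" 0] s2[of "-2" 0]
      by (simp add: ac_simps)
  qed
qed

text \<open>
  For \<open>t = 2\<close> and \<open>t = 3\<close> these are the five translates of the lattices spanned by the quarter turns of
  \<open>(1, 2)\<close> and of \<open>(2, 1)\<close>, respectively.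
\<close>

definition code :: "int \<Rightarrow> int \<Rightarrow> config" where
  "code t c = (\<lambda>(x, y). (x + t * y) mod 5 = c)"

text \<open>
  The cross is a complete set of residues for \<open>(x, y) \<mapsto> x + t y\<close> modulo 5, since its values are
  \<open>0\<close>, \<open>\<plusminus>1\<close> and \<open>\<plusminus>t\<close>.
\<close>

lemma cross_residues:
  fixes t :: int
  assumes "t \<in> {2, 3}"
  shows "inj_on (\<lambda>w. (fst w + t * snd w) mod 5) cross"
    and "(\<lambda>w. (fst w + t * snd w) mod 5) ` cross = {0, 1, 2, 3, 4}"
proof -
  consider "t = 2" | "t = 3" using assms by blast
  then have "inj_on (\<lambda>w. (fst w + t * snd w) mod 5) cross \<and>
    (\<lambda>w. (fst w + t * snd w) mod 5) ` cross = {0, 1, 2, 3, 4}"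
    by cases (simp_all add: cross_def insert_commute)
  then show "inj_on (\<lambda>w. (fst w + t * snd w) mod 5) cross"
    "(\<lambda>w. (fst w + t * snd w) mod 5) ` cross = {0, 1, 2, 3, 4}" by blast+
qed

lemma perfect_code:
  assumes t: "t \<in> {2, 3}" and c: "c \<in> {0..4}"
  shows "perfect (code t c)"
proof -
  have "\<exists>!w. w \<in> cross \<and> code t c ((x, y) + w)" for x y
  proof -
    define s where "s = (c - (x + t * y)) mod 5"
    have eq: "code t c ((x, y) + w) \<longleftrightarrow> (fst w + t * snd w) mod 5 = s" for w
    proof -
      have "code t c ((x, y) + w) \<longleftrightarrow> (x + fst w + t * (y + snd w)) mod 5 = c mod 5"
        using c by (cases w) (simp add: code_def)
      also have "\<dots> \<longleftrightarrow> (fst w + t * snd w) mod 5 = s"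
        unfolding s_def by (simp add: mod_eq_dvd_iff algebra_simps)
      finally show ?thesis .
    qed
    have "s \<in> {0, 1, 2, 3, 4}" unfolding s_def by auto
    then obtain w where "w \<in> cross" "s = (fst w + t * snd w) mod 5"
      unfolding cross_residues(2)[OF t, symmetric] by blast
    then show ?thesis
      unfolding eq using inj_onD[OF cross_residues(1)[OF t]] by (intro ex1I[of _ w]) metis+
  qed
  then show ?thesis by (simp add: perfect_def)
qed

text \<open>
  The quarter turns of the given knight move surround the first site by four occupied sites.  Each
  of these sees the first site at a knight move of the same kind, so the pattern spreads to the
  whole lattice generated by \<open>(2, 1)\<close> and \<open>(1, -2)\<close>.  This lattice translate is already a perfect
  code, and there is no room for further sites.
\<close>

lemma perfect_code_from_knight:
  assumes P: "perfect \<omega>" and 1: "\<omega> (p, q)" and 2: "\<omega> (p + 2, q + 1)"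
  shows "\<omega> = code 3 ((p + 3 * q) mod 5)"
proof -
  \<comment> \<open>\<open>T x y\<close>: the site is occupied together with all four quarter turns of the knight move.\<close>
  define T where "T x y \<longleftrightarrow> \<omega> (x, y) \<and> \<omega> (x + 2, y + 1) \<and> \<omega> (x + 1, y - 2)
    \<and> \<omega> (x - 2, y - 1) \<and> \<omega> (x - 1, y + 2)" for x y
  have turn: "\<omega> (x + 2, y + 1) \<Longrightarrow> \<omega> (x + 1, y - 2)" "\<omega> (x + 1, y - 2) \<Longrightarrow> \<omega> (x - 2, y - 1)"
    "\<omega> (x - 2, y - 1) \<Longrightarrow> \<omega> (x - 1, y + 2)" "\<omega> (x - 1, y + 2) \<Longrightarrow> \<omega> (x + 2, y + 1)"
    if "\<omega> (x, y)" for x y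
    using knight_turn[OF P _ that, of 1 0] knight_turn[OF P _ that, of 0 "-1"]
      knight_turn[OF P _ that, of "-1" 0] knight_turn[OF P _ that, of 0 1] by simp_all
  have T: "T x y"
    if "\<omega> (x, y)" "\<omega> (x + 2, y + 1) \<or> \<omega> (x + 1, y - 2) \<or> \<omega> (x - 2, y - 1) \<or> \<omega> (x - 1, y + 2)" for x y
    using turn[OF that(1)] that unfolding T_def by blast
  have move: "T (x + 2) (y + 1)" "T (x + 1) (y - 2)" "T (x - 2) (y - 1)" "T (x - 1) (y + 2)"
    if "T x y" for x y
    using that by (intro T; simp add: T_def)+
  have "T (p + 2 * m) (q + m)" for m
  proof (induction m rule: int_induct[where k = 0])
    case base show ?case using T 1 2 by simp
  next
    case (step1 i) then show ?case using move(1) by (force simp: algebra_simps)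
  next
    case (step2 i) then show ?case using move(3) by (force simp: algebra_simps)
  qed
  then have "T (p + 2 * m + n) (q + m - 2 * n)" for m n
  proof (induction n rule: int_induct[where k = 0])
    case (step1 i) then show ?case using move(2) by (force simp: algebra_simps)
  next
    case (step2 i) then show ?case using move(4) by (force simp: algebra_simps)
  qed simp
  then have lat: "\<omega> (p + 2 * m + n, q + m - 2 * n)" for m n unfolding T_def by blast
  let ?c = "code 3 ((p + 3 * q) mod 5)"
  have sub: "\<omega> (x, y)" if "?c (x, y)" for x y
  proof -
    have "5 dvd (x + 3 * y) - (p + 3 * q)" using that by (simp add: code_def mod_eq_dvd_iff)
    then obtain k where k: "(x + 3 * y) - (p + 3 * q) = 5 * k" by blast
    \<comment> \<open>The coordinates with respect to the basis \<open>(2, 1)\<close>, \<open>(1, -2)\<close> are \<open>y - q + 2 n\<close> and \<open>n\<close>.\<close>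
    define n where "n = k - (y - q)"
    have "x = p + 2 * (y - q + 2 * n) + n" "y = q + (y - q + 2 * n) - 2 * n"
      using k by (simp_all add: n_def)
    then show ?thesis using lat by metis
  qed
  have "perfect ?c" by (rule perfect_code) auto
  have "?c (x, y)" if "\<omega> (x, y)" for x y
  proof -
    have "\<omega> (x + u, y + v) \<Longrightarrow> \<bar>u\<bar> + \<bar>v\<bar> \<le> 2 \<Longrightarrow> u = 0 \<and> v = 0" for u v
      using perfect_separated[OF P that] by blast
    from this[of 1 0] this[of "-1" 0] this[of 0 1] this[of 0 "-1"]
    show ?thesis using perfect_dominates[OF \<open>perfect ?c\<close>, of x y] sub by auto
  qed
  then show ?thesis using sub by (auto simp: fun_eq_iff)
qed

lemma perfect_swap:
  assumes "perfect \<omega>" shows "perfect (\<lambda>i. \<omega> (prod.swap i))"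
  unfolding perfect_def
proof
  fix i :: site
  have s: "prod.swap w \<in> cross \<longleftrightarrow> w \<in> cross" for w by (cases w) (auto simp: cross_def)
  have a: "prod.swap (i + w) = prod.swap i + prod.swap w" for w by (simp add: prod_eq_iff)
  obtain w where w: "w \<in> cross" "\<omega> (prod.swap i + w)"
    and uniq: "\<And>v. v \<in> cross \<Longrightarrow> \<omega> (prod.swap i + v) \<Longrightarrow> v = w"
    using assms unfolding perfect_def by metis
  show "\<exists>!w. w \<in> cross \<and> \<omega> (prod.swap (i + w))"
    unfolding a
  proof (intro ex1I conjI; (elim conjE)?)
    show "prod.swap w \<in> cross" "\<omega> (prod.swap i + prod.swap (prod.swap w))"
      using w by (simp_all only: s swap_swap)
    fix v assume "v \<in> cross" "\<omega> (prod.swap i + prod.swap v)"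
    then have "prod.swap v = w" using uniq by (simp only: s)
    then show "v = prod.swap w" by (simp only: swap_swap flip: \<open>prod.swap v = w\<close>)
  qed
qed

text \<open>
  The site at offset \<open>(1, 1)\<close> from an occupied site can only be covered by a site at offset \<open>(2, 1)\<close>
  or \<open>(1, 2)\<close>.  Reflection in the diagonal exchanges the two cases.
\<close>

lemma perfect_iff: "perfect \<omega> \<longleftrightarrow> (\<exists>t\<in>{2, 3}. \<exists>c\<in>{0..4}. \<omega> = code t c)"
proof
  assume P: "perfect \<omega>"
  obtain x y where o: "\<omega> (x, y)" using perfect_dominates[OF P] by blast
  have "\<omega> (x + 2, y + 1) \<or> \<omega> (x + 1, y + 2)"
    using perfect_dominates[OF P, of "x + 1" "y + 1"] perfect_separated[OF P o, of 1 1]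
      perfect_separated[OF P o, of 1 0] perfect_separated[OF P o, of 0 1]
    by (auto simp: ac_simps)
  then show "\<exists>t\<in>{2, 3}. \<exists>c\<in>{0..4}. \<omega> = code t c"
  proof
    assume "\<omega> (x + 2, y + 1)"
    then have "\<omega> = code 3 ((x + 3 * y) mod 5)" using perfect_code_from_knight[OF P o] by blast
    moreover have "(x + 3 * y) mod 5 \<in> {0..4}" by auto
    ultimately show ?thesis by blast
  next
    assume "\<omega> (x + 1, y + 2)"
    then have "(\<lambda>i. \<omega> (prod.swap i)) = code 3 ((y + 3 * x) mod 5)"
      using perfect_code_from_knight[OF perfect_swap[OF P], of y x] o by simp
    then have "\<omega> (a, b) \<longleftrightarrow> (b + 3 * a) mod 5 = (y + 3 * x) mod 5" for a b
      by (auto simp: fun_eq_iff code_def)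
    \<comment> \<open>Doubling \<open>b + 3 a\<close> gives \<open>a + 2 b\<close> modulo 5, and tripling undoes this.\<close>
    moreover have "(b + 3 * a) mod 5 = (y + 3 * x) mod 5 \<longleftrightarrow> (a + 2 * b) mod 5 = (x + 2 * y) mod 5"
      for a b
    proof -
      have "5 dvd u \<longleftrightarrow> 5 dvd v" if "v = 2 * u - 5 * m" "u = 3 * v - 5 * n" for u v m n :: int
        using that by (metis dvd_diff dvd_mult dvd_triv_left)
      from this[of "(a + 2 * b) - (x + 2 * y)" "(b + 3 * a) - (y + 3 * x)" "a - x" "b - y"]
      show ?thesis by (simp add: mod_eq_dvd_iff algebra_simps)
    qed
    ultimately have "\<omega> = code 2 ((x + 2 * y) mod 5)" by (auto simp: fun_eq_iff code_def)
    moreover have "(x + 2 * y) mod 5 \<in> {0..4}" by auto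
    ultimately show ?thesis by blast
  qed
qed (use perfect_code in blast)

lemma periodic_code: "periodic (code t c)"
proof -
  have "(a + 5 + t * b) mod 5 = (a + t * b) mod 5" "(a + t * (b + 5)) mod 5 = (a + t * b) mod 5" for a b
    by (simp_all add: mod_eq_dvd_iff algebra_simps)
  then have "is_period (code t c) (5, 0)" "is_period (code t c) (0, 5)"
    by (simp_all add: is_period_def code_def)
  then show ?thesis
    unfolding periodic_def by (intro exI[of _ "(5, 0)"] exI[of _ "(0, 5)"]) simp
qed

lemma density_fifth: "{\<omega> \<in> X0_per. density \<omega> = 1/5} = (\<lambda>(t, c). code t c) ` ({2, 3} \<times> {0..4})"
proof -
  have "\<omega> \<in> X0_per" if "perfect \<omega>" for \<omega>
    using that perfect_imp_X0 periodic_code unfolding X0_per_def perfect_iff by auto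
  then have "{\<omega> \<in> X0_per. density \<omega> = 1/5} = {\<omega>. perfect \<omega>}"
    using cross_density(2) by auto
  then show ?thesis unfolding perfect_iff by (auto simp: image_iff)
qed

lemma inj_code: "inj_on (\<lambda>(t, c). code t c) ({2, 3} \<times> {0..4})"
proof (rule inj_onI, clarify)
  fix t c t' c' :: int
  assume t: "t \<in> {2, 3}" "t' \<in> {2, 3}" and c: "c \<in> {0..4}" "c' \<in> {0..4}"
    and "code t c = code t' c'"
  then have eq: "(x + t * y) mod 5 = c \<longleftrightarrow> (x + t' * y) mod 5 = c'" for x y
    by (auto simp: code_def fun_eq_iff)
  have "c = c'" using eq[of c 0] c by auto
  moreover have "t = t'"
    \<comment> \<open>The site \<open>(c - t, 1)\<close> lies in the code with slope \<open>t\<close>, and in the other one only if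
      \<open>t' = t\<close> modulo 5.\<close>
    using eq[of "c - t" 1] t c \<open>c = c'\<close> by auto presburger+
  ultimately show "t = t' \<and> c = c'" by simp
qed

theorem theorem6p1:
  "(\<forall>\<omega> \<in> X0_per. convergent (box_density \<omega>) \<and> 1/5 \<le> density \<omega> \<and> density \<omega> \<le> 1/2) \<and>
   card {\<omega> \<in> X0_per. density \<omega> = 1/2} = 2 \<and>
   card {\<omega> \<in> X0_per. density \<omega> = 1/5} = 10"
proof (intro conjI ballI)
  fix \<omega> assume \<omega>: "\<omega> \<in> X0_per"
  show "convergent (box_density \<omega>)" using \<omega> periodic_density unfolding X0_per_def by blast
  show "1/5 \<le> density \<omega>" by (rule cross_density(1)[OF \<omega>])
  show "density \<omega> \<le> 1/2" using domino_density(1)[OF \<omega>, of "(1, 0)"] by simp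
next
  show "card {\<omega> \<in> X0_per. density \<omega> = 1/2} = 2"
    unfolding density_half by (simp add: card_image[OF inj_checkerboard])
  show "card {\<omega> \<in> X0_per. density \<omega> = 1/5} = 10"
    unfolding density_fifth by (simp only: card_image[OF inj_code]) simp
qed

end
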